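(* Let $(x_j,y_j)\in\mathbb{R}_{\ge 0}^m\times\mathbb{R}_{\ge 0}^s$ ($j=1,\dots,n$) be input-output data with $x_j\ne0$, $y_j\ne 0$, let $o\in\{1,\dots,n\}$, $J=\{1,\dots,n\}\setminus\{o\}$, and let $g^-\in\mathbb{R}^m$ have all components strictly positive. Then the constant-returns-to-scale non-radial input-oriented directional super-efficiency model for $\mathrm{DMU}_o$, $$\min\ 1+\sum_{i=1}^m\tau_i^-\quad\text{subject to}\quad \sum_{j\in J}\lambda_j x_{ij}\le x_{io}+\tau_i^- g_i^-\ (i=1,\dots,m),\quad \sum_{j\in J}\lambda_j y_{rj}\ge y_{ro}\ (r=1,\dots,s),$$ $$\lambda_j\ge 0\ (j\in J),\quad \tau_i^-\ge 0\ (i=1,\dots,m),$$ is feasible (its constraints admit a solution) if and only if $Q_o=\emptyset$, where $$Q_o=\Bigl\{r\in\{1,\dots,s\}\ \Big|\ \sum_{j=1,\,j\ne o}^n y_{rj}=0,\ y_{ro}>0\Bigr\}.$$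
   Context: There are $n$ decision making units; $\mathrm{DMU}_j$ uses inputs $x_j=(x_{1j},\dots,x_{mj})$ to produce outputs $y_j=(y_{1j},\dots,y_{sj})$. $\mathrm{DMU}_o$ is the unit under evaluation and is excluded from the reference set $J$. The vector $g^-$ is the input part of the direction vector (the output part is $0$). Constant returns to scale means that the only restriction on the $\lambda_j$ individually or jointly, besides the input and output constraints, is nonnegativity (lower bound $L=0$ and upper bound $U=\infty$ on $\sum_{j\in J}\lambda_j$). *)

theory Defs
  imports "HOL-Analysis.Analysis"
begin

text \<open>
  The decision making units, the inputs and the outputs are indexed by the finite types
  \<open>'n\<close>, \<open>'m\<close> and \<open>'s\<close>; \<open>x j $ i\<close> and \<open>y j $ r\<close> are the quantities usually written
  $x_{ij}$ and $y_{rj}$, and \<open>k\<close> is the unit under evaluation.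
\<close>

datatype 'a min_problem =
  Min_Problem (objective: "'a \<Rightarrow> real") (feasible_set: "'a set")

definition feasible :: "'a min_problem \<Rightarrow> bool" where
  "feasible P \<longleftrightarrow> feasible_set P \<noteq> {}"

definition ref_set :: "'n \<Rightarrow> 'n set" where
  "ref_set k = UNIV - {k}"

text \<open>
  A decision variable is a pair of intensities and slacks.  The intensities are a family
  indexed by the reference set only, hence the extensional function space: there is no
  intensity for the unit \<open>k\<close> itself.  Under constant returns to scale their sum is
  unrestricted.
\<close>

definition crs_super_efficiency_model ::
    "('n::finite \<Rightarrow> real ^ 'm::finite) \<Rightarrow> ('n \<Rightarrow> real ^ 's) \<Rightarrow> real ^ 'm \<Rightarrow> 'n
      \<Rightarrow> (('n \<Rightarrow> real) \<times> (real ^ 'm)) min_problem" where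
  "crs_super_efficiency_model x y g k =
    Min_Problem
      (\<lambda>(lam, tau). 1 + (\<Sum>i\<in>UNIV. tau $ i))
      {(lam, tau).
        (\<forall>i. (\<Sum>j\<in>ref_set k. lam j * x j $ i) \<le> x k $ i + tau $ i * g $ i) \<and>
        (\<forall>r. (\<Sum>j\<in>ref_set k. lam j * y j $ r) \<ge> y k $ r) \<and>
        lam \<in> ref_set k \<rightarrow>\<^sub>E {0..} \<and>
        (\<forall>i. tau $ i \<ge> 0)}"

definition Q_set :: "('n::finite \<Rightarrow> real ^ 's) \<Rightarrow> 'n \<Rightarrow> 's set" where
  "Q_set y k = {r. (\<Sum>j\<in>ref_set k. y j $ r) = 0 \<and> y k $ r > 0}"

end

theory Submission
  imports Defs
begin

text \<open>
  An output that no reference unit produces cannot be covered by any combination of the reference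
  units.  Otherwise each output is covered by giving all reference units one common, sufficiently
  large intensity; under constant returns to scale nothing bounds it, and since the direction is
  positive the slacks absorb the resulting inputs.
\<close>

theorem theorem4p5p2:
  fixes x :: "'n::finite \<Rightarrow> real ^ 'm::finite"
    and y :: "'n \<Rightarrow> real ^ 's::finite"
    and g :: "real ^ 'm"
    and k :: 'n
  assumes "\<And>j i. x j $ i \<ge> 0"
    and "\<And>j r. y j $ r \<ge> 0"
    and "\<And>j. x j \<noteq> 0"
    and "\<And>j. y j \<noteq> 0"
    and "\<And>i. g $ i > 0"
  shows "feasible (crs_super_efficiency_model x y g k) \<longleftrightarrow> Q_set y k = {}"
proof
  assume "feasible (crs_super_efficiency_model x y g k)"
  then obtain lam where
    cover: "\<And>r. y k $ r \<le> (\<Sum>j\<in>ref_set k. lam j * y j $ r)"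
    by (auto simp: feasible_def crs_super_efficiency_model_def)
  show "Q_set y k = {}"
  proof (rule ccontr)
    assume "Q_set y k \<noteq> {}"
    then obtain r where zero: "(\<Sum>j\<in>ref_set k. y j $ r) = 0" and pos: "y k $ r > 0"
      by (auto simp: Q_set_def)
    \<comment> \<open>Outputs are nonnegative, so a vanishing sum leaves no nonzero term, whatever
      the intensities.\<close>
    have "\<forall>j\<in>ref_set k. y j $ r = 0"
      using zero assms(2) by (simp add: sum_nonneg_eq_0_iff)
    then have "(\<Sum>j\<in>ref_set k. lam j * y j $ r) = 0"
      by simp
    with cover[of r] pos show False
      by simp
  qed
next
  assume empty: "Q_set y k = {}"
  define S where "S r = (\<Sum>j\<in>ref_set k. y j $ r)" for r
  define X where "X i = (\<Sum>j\<in>ref_set k. x j $ i)" for i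
  \<comment> \<open>Terms with \<open>S r = 0\<close> vanish, as division by zero gives zero.\<close>
  define c where "c = (\<Sum>r\<in>UNIV. y k $ r / S r)"
  \<comment> \<open>Restriction makes \<open>lam\<close> undefined at \<open>k\<close>, as the
    extensional function space demands.\<close>
  define lam where "lam = restrict (\<lambda>_. c) (ref_set k)"
  \<comment> \<open>Chosen so that \<open>tau $ i * g $ i = c * X i\<close>, the entire input used;
    \<open>x k $ i \<ge> 0\<close> is then spare.\<close>
  define tau :: "real ^ 'm" where "tau = (\<chi> i. c * X i / g $ i)"
  have S_nonneg: "S r \<ge> 0" for r
    unfolding S_def by (intro sum_nonneg assms(2))
  have X_nonneg: "X i \<ge> 0" for i
    unfolding X_def by (intro sum_nonneg assms(1))
  have c_nonneg: "c \<ge> 0"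
    unfolding c_def by (intro sum_nonneg divide_nonneg_nonneg assms(2) S_nonneg)
  have cover: "y k $ r \<le> c * S r" for r
  proof (cases "S r = 0")
    \<comment> \<open>Here \<open>c * S r = 0\<close>, and \<open>r \<notin> Q_set y k\<close> rules
      out \<open>y k $ r > 0\<close>.\<close>
    case True
    then show ?thesis
      using empty by (auto simp: Q_set_def S_def not_less)
  next
    case False
    \<comment> \<open>All ratios are nonnegative, so their sum \<open>c\<close> bounds each one and
      can stand in for their maximum.\<close>
    have "y k $ r / S r \<le> c"
      unfolding c_def by (rule member_le_sum) (auto intro: divide_nonneg_nonneg assms(2) S_nonneg)
    with False S_nonneg[of r] show ?thesis
      by (simp add: pos_divide_le_eq)
  qed
  have lam_sum: "(\<Sum>j\<in>ref_set k. lam j * f j) = c * (\<Sum>j\<in>ref_set k. f j)" for f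
    by (simp add: lam_def sum_distrib_left)
  have "(\<Sum>j\<in>ref_set k. lam j * x j $ i) \<le> x k $ i + tau $ i * g $ i" for i
    using assms(1)[of k i] assms(5)[of i] by (simp add: lam_sum tau_def X_def)
  moreover have "y k $ r \<le> (\<Sum>j\<in>ref_set k. lam j * y j $ r)" for r
    using cover[of r] by (simp add: lam_sum S_def)
  moreover have "lam \<in> ref_set k \<rightarrow>\<^sub>E {0..}"
    using c_nonneg by (simp add: lam_def)
  moreover have "tau $ i \<ge> 0" for i
    using c_nonneg X_nonneg[of i] assms(5)[of i] by (simp add: tau_def)
  ultimately show "feasible (crs_super_efficiency_model x y g k)"
    unfolding feasible_def crs_super_efficiency_model_def by auto
qed

end
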